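(* Let $a>0$, $b\ge 0$ and $\gamma>0$, and let $\pi(\theta)$, $\theta\in\mathbb{R}$, be the log-adjusted shrinkage prior with hyperparameters $(a,b,\gamma)$, i.e. (up to a normalizing constant) $$\pi(\theta)\propto\int_0^\infty \frac{1}{\sqrt{2\pi u}}\,e^{-\theta^2/(2u)}\,u^{a-1}(1+u)^{-(a+b)}\{1+\log(1+u)\}^{-(1+\gamma)}\,du .$$ Then the following hold. 1. $\pi(\theta)$ is proper, i.e. the integral over $\theta\in\mathbb{R}$ of the right-hand side is finite (for all $a>0$, $b\ge0$, $\gamma>0$). 2. If $a\le 1/2$, then $\lim_{|\theta|\to 0}\pi(\theta)=\infty$. 3. As $|\theta|\to\infty$, $\pi(\theta)\propto|\theta|^{-2b-1}\,\ell(|\theta|)$ for some slowly varying function $\ell$; that is, there are a constant $c>0$ and a slowly varying function $\ell$ such that $\pi(\theta)/\{c\,|\theta|^{-2b-1}\ell(|\theta|)\}\to 1$ as $|\theta|\to\infty$.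
   Context: The log-adjusted shrinkage prior is the normal scale mixture $\theta\mid u\sim N(0,u)$ (mean $0$, variance $u$), with $u>0$ having density proportional to $u^{a-1}(1+u)^{-(a+b)}\{1+\log(1+u)\}^{-(1+\gamma)}$. A positive function $\ell$ on $(0,\infty)$ is slowly varying (at infinity) if $\lim_{M\to\infty}\ell(Mv)/\ell(M)=1$ for all $v>0$. *)

theory Defs
  imports "HOL-Probability.Probability"
begin

definition las_mixing_kernel :: "real \<Rightarrow> real \<Rightarrow> real \<Rightarrow> real \<Rightarrow> real" where
  "las_mixing_kernel a b \<gamma> u =
     u powr (a - 1) * (1 + u) powr (- (a + b)) * (1 + ln (1 + u)) powr (- (1 + \<gamma>))"

text \<open>
  The unnormalized density takes values in the extended nonnegative reals: the integral
  is infinite at \<open>\<theta> = 0\<close> when \<open>a \<le> 1/2\<close>. In \<^const>\<open>normal_density\<close> the scale argument is the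
  standard deviation, so variance \<open>u\<close> corresponds to \<open>sqrt u\<close>.
\<close>

definition las_kernel :: "real \<Rightarrow> real \<Rightarrow> real \<Rightarrow> real \<Rightarrow> ennreal" where
  "las_kernel a b \<gamma> \<theta> =
     (\<integral>\<^sup>+u\<in>{0<..}. ennreal (normal_density 0 (sqrt u) \<theta> * las_mixing_kernel a b \<gamma> u) \<partial>lborel)"

lemma las_kernel_explicit:
  "las_kernel a b \<gamma> \<theta> =
     (\<integral>\<^sup>+u\<in>{0<..}. ennreal (1 / sqrt (2 * pi * u) * exp (- \<theta>\<^sup>2 / (2 * u)) *
        u powr (a - 1) * (1 + u) powr (- (a + b)) * (1 + ln (1 + u)) powr (- (1 + \<gamma>))) \<partial>lborel)"
  unfolding las_kernel_def las_mixing_kernel_def normal_density_def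
  by (intro nn_integral_cong) (auto simp: indicator_def mult.assoc)

text \<open>
  The prior is determined only up to a constant; any positive finite multiple of the kernel
  is admitted, in particular the kernel itself and the normalized density.
\<close>

definition log_adjusted_shrinkage_prior ::
    "real \<Rightarrow> real \<Rightarrow> real \<Rightarrow> (real \<Rightarrow> ennreal) \<Rightarrow> bool" where
  "log_adjusted_shrinkage_prior a b \<gamma> \<pi> \<longleftrightarrow>
     (\<exists>K::real. K > 0 \<and> (\<forall>\<theta>. \<pi> \<theta> = ennreal K * las_kernel a b \<gamma> \<theta>))"

definition slowly_varying :: "(real \<Rightarrow> real) \<Rightarrow> bool" where
  "slowly_varying l \<longleftrightarrow>
     (\<forall>x>0. l x > 0) \<and> (\<forall>v>0. ((\<lambda>M. l (M * v) / l M) \<longlongrightarrow> 1) at_top)"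

end

theory Submission
  imports Defs "HOL-Real_Asymp.Real_Asymp"
begin

text \<open>
  Properness is Tonelli's theorem together with integrability of the mixing kernel, whose tail
  is at most a multiple of the derivative of \<open>-(1 + ln (1 + u)) powr (-\<gamma>)\<close>. For the pole at
  \<open>0\<close>, the range \<open>\<theta>\<^sup>2 \<le> u \<le> 1\<close> alone contributes at least a multiple of \<open>\<integral> du / u = - ln (\<theta>\<^sup>2)\<close>
  when \<open>a \<le> 1/2\<close>.

  For the tail, the substitution \<open>u = \<theta>\<^sup>2 v\<close> extracts the factor
  \<open>\<bar>\<theta>\<bar> powr (-2b - 1) * (1 + ln (1 + \<theta>\<^sup>2)) powr (-(1 + \<gamma>))\<close> and leaves the integral of an
  inverse gamma kernel in \<open>v\<close> times a ratio that tends to \<open>1\<close> pointwise. The ratio is at most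
  \<open>1 + v powr (-(1 + \<gamma>))\<close> uniformly in \<open>\<theta>\<close>, so dominated convergence applies.
\<close>

section \<open>Properness: integrability of the mixing kernel\<close>

lemma borel_measurable_las_mixing_kernel [measurable]:
  "las_mixing_kernel a b \<gamma> \<in> borel_measurable borel"
  unfolding las_mixing_kernel_def by measurable

lemma las_mixing_kernel_nonneg: "las_mixing_kernel a b \<gamma> u \<ge> 0"
  unfolding las_mixing_kernel_def by simp

lemma nn_integral_powr_at_0:
  fixes a :: real
  assumes "a > 0"
  shows "(\<integral>\<^sup>+u\<in>{0..1}. ennreal (u powr (a - 1)) \<partial>lborel) < \<infinity>"
proof -
  have "((\<lambda>u. u powr (a - 1)) has_integral (1 / a)) {0..1}"
    using has_integral_powr_from_0[of "a - 1" 1] assms by simp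
  then have "(\<integral>\<^sup>+u\<in>{0..1}. ennreal (u powr (a - 1)) \<partial>lborel) = ennreal (1 / a)"
    by (intro nn_integral_has_integral_lebesgue') auto
  then show ?thesis by simp
qed

lemma nn_integral_powr_at_top:
  fixes p :: real
  assumes "p > 1"
  shows "(\<integral>\<^sup>+u\<in>{1..}. ennreal (u powr (- p)) \<partial>lborel) < \<infinity>"
proof -
  have "(\<integral>\<^sup>+u\<in>{1..}. ennreal (u powr (- p)) \<partial>lborel) = ennreal (0 - 1 powr (1 - p) / (1 - p))"
  proof (rule nn_integral_FTC_atLeast[where F = "\<lambda>u. u powr (1 - p) / (1 - p)"])
    show "((\<lambda>u. u powr (1 - p) / (1 - p)) \<longlongrightarrow> 0) at_top"
      using assms by real_asymp
    show "((\<lambda>u. u powr (1 - p) / (1 - p)) has_real_derivative u powr (- p)) (at u)"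
      if "1 \<le> u" for u
      using that assms by (auto intro!: derivative_eq_intros)
  qed auto
  then show ?thesis by simp
qed

text \<open>This carries the borderline case \<open>b = 0\<close>: the integral of
  \<open>1 / (1 + u)\<close> alone diverges logarithmically, and \<open>\<gamma> > 0\<close> is what
  makes the antiderivative vanish at infinity.\<close>

lemma nn_integral_log_powr_at_top:
  fixes \<gamma> :: real
  assumes "\<gamma> > 0"
  shows "(\<integral>\<^sup>+u\<in>{1..}. ennreal (inverse (1 + u) * (1 + ln (1 + u)) powr (- (1 + \<gamma>))) \<partial>lborel) < \<infinity>"
proof -
  let ?F = "\<lambda>u::real. - ((1 + ln (1 + u)) powr (- \<gamma>) / \<gamma>)"
  have "(\<integral>\<^sup>+u\<in>{1..}. ennreal (inverse (1 + u) * (1 + ln (1 + u)) powr (- (1 + \<gamma>))) \<partial>lborel)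
      = ennreal (0 - ?F 1)"
  proof (rule nn_integral_FTC_atLeast[where F = ?F])
    show "(?F \<longlongrightarrow> 0) at_top"
      using assms by real_asymp
    show "(?F has_real_derivative inverse (1 + u) * (1 + ln (1 + u)) powr (- (1 + \<gamma>))) (at u)"
      if "1 \<le> u" for u
    proof -
      have pos: "0 < 1 + ln (1 + u)"
        using that by (simp add: add_pos_nonneg)
      have "(?F has_real_derivative
          - (- \<gamma> * (1 + ln (1 + u)) powr (- 1 - \<gamma>) * (1 / (1 + u)) / \<gamma>)) (at u)"
        using that pos by (auto intro!: derivative_eq_intros simp: minus_diff_commute)
      also have "- (- \<gamma> * (1 + ln (1 + u)) powr (- 1 - \<gamma>) * (1 / (1 + u)) / \<gamma>)
          = inverse (1 + u) * (1 + ln (1 + u)) powr (- (1 + \<gamma>))"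
        using assms by (simp add: divide_inverse)
      finally show ?thesis .
    qed
  qed auto
  then show ?thesis by simp
qed

lemma las_mixing_kernel_le_powr:
  assumes "u > 0" "a > 0" "b \<ge> 0" "\<gamma> > 0"
  shows "las_mixing_kernel a b \<gamma> u \<le> u powr (a - 1)"
proof -
  have "(1 + u) powr (- (a + b)) \<le> 1 powr (- (a + b))"
    using assms by (intro powr_mono2') auto
  moreover have "(1 + ln (1 + u)) powr (- (1 + \<gamma>)) \<le> 1 powr (- (1 + \<gamma>))"
    using assms by (intro powr_mono2') auto
  ultimately have "(1 + u) powr (- (a + b)) * (1 + ln (1 + u)) powr (- (1 + \<gamma>)) \<le> 1"
    by (intro mult_le_one) auto
  then have "u powr (a - 1) * ((1 + u) powr (- (a + b)) * (1 + ln (1 + u)) powr (- (1 + \<gamma>)))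
      \<le> u powr (a - 1) * 1"
    by (intro mult_left_mono) auto
  then show ?thesis
    by (simp add: las_mixing_kernel_def mult.assoc)
qed

text \<open>By \<open>b \<ge> 0\<close> the factor \<open>(1 + u) powr (- b)\<close> is at most
  \<open>1\<close>. The remaining powers combine to
  \<open>(u / (1 + u)) powr a / u \<le> 1 / u\<close>, and the factor \<open>2\<close> pays for
  replacing \<open>u\<close> by \<open>1 + u\<close> when \<open>u \<ge> 1\<close>.\<close>

lemma las_mixing_kernel_le_log:
  assumes "u \<ge> 1" "a > 0" "b \<ge> 0"
  shows "las_mixing_kernel a b \<gamma> u \<le> 2 * (inverse (1 + u) * (1 + ln (1 + u)) powr (- (1 + \<gamma>)))"
proof -
  have "u powr (a - 1) * (1 + u) powr (- (a + b)) \<le> u powr (a - 1) * (1 + u) powr (- a)"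
    using assms by (intro mult_left_mono powr_mono) auto
  also have "\<dots> = (u / (1 + u)) powr a / u"
    using assms by (simp add: powr_diff powr_minus powr_divide field_simps)
  also have "\<dots> \<le> 1 / u"
    using assms by (intro divide_right_mono powr_le1) auto
  also have "\<dots> \<le> 2 * inverse (1 + u)"
    using assms by (simp add: field_simps)
  finally have "u powr (a - 1) * (1 + u) powr (- (a + b)) * (1 + ln (1 + u)) powr (- (1 + \<gamma>))
      \<le> 2 * inverse (1 + u) * (1 + ln (1 + u)) powr (- (1 + \<gamma>))"
    by (intro mult_right_mono) auto
  then show ?thesis
    by (simp add: las_mixing_kernel_def mult.assoc)
qed

lemma nn_integral_las_mixing_kernel_finite:
  assumes "a > 0" "b \<ge> 0" "\<gamma> > 0"
  shows "(\<integral>\<^sup>+u\<in>{0<..}. ennreal (las_mixing_kernel a b \<gamma> u) \<partial>lborel) < \<infinity>"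
proof -
  \<comment> \<open>The half-line is cut at \<open>1\<close>: the pure power dominates below,
    \<open>2 * ?g\<close> above. Counting \<open>u = 1\<close> twice is harmless in an upper
    bound.\<close>
  let ?g = "\<lambda>u. inverse (1 + u) * (1 + ln (1 + u)) powr (- (1 + \<gamma>))"
  have "(\<integral>\<^sup>+u\<in>{0<..}. ennreal (las_mixing_kernel a b \<gamma> u) \<partial>lborel)
      \<le> (\<integral>\<^sup>+u. ennreal (u powr (a - 1)) * indicator {0..1} u
          + 2 * (ennreal (?g u) * indicator {1..} u) \<partial>lborel)"
  proof (rule nn_integral_mono)
    fix u :: real
    consider "u \<le> 0" | "0 < u" "u < 1" | "1 \<le> u" by linarith
    then show "ennreal (las_mixing_kernel a b \<gamma> u) * indicator {0<..} u
        \<le> ennreal (u powr (a - 1)) * indicator {0..1} u + 2 * (ennreal (?g u) * indicator {1..} u)"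
    proof cases
      case 2
      then show ?thesis
        using las_mixing_kernel_le_powr[of u a b \<gamma>] assms by (auto intro: ennreal_leI)
    next
      case 3
      then have "ennreal (las_mixing_kernel a b \<gamma> u) \<le> ennreal (2 * ?g u)"
        using las_mixing_kernel_le_log[of u a b \<gamma>] assms by (intro ennreal_leI) auto
      also have "\<dots> = 2 * ennreal (?g u)"
        using 3 by (subst ennreal_mult) auto
      also have "\<dots> \<le> ennreal (u powr (a - 1)) * indicator {0..1} u + 2 * ennreal (?g u)"
        by (intro add_increasing) auto
      finally show ?thesis
        using 3 by simp
    qed auto
  qed
  also have "\<dots> = (\<integral>\<^sup>+u\<in>{0..1}. ennreal (u powr (a - 1)) \<partial>lborel)
      + 2 * (\<integral>\<^sup>+u\<in>{1..}. ennreal (?g u) \<partial>lborel)"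
    by (subst nn_integral_add) (auto simp: nn_integral_cmult)
  also have "\<dots> < \<infinity>"
    using nn_integral_powr_at_0[OF assms(1)] nn_integral_log_powr_at_top[OF assms(3)]
    by (auto simp: ennreal_mult_less_top)
  finally show ?thesis .
qed

text \<open>After the integrals are swapped, the inner one is the total mass \<open>1\<close> of a
  normal density. Both sides may be infinite, so this precedes any finiteness argument.\<close>

lemma nn_integral_las_kernel:
  "(\<integral>\<^sup>+\<theta>. las_kernel a b \<gamma> \<theta> \<partial>lborel)
    = (\<integral>\<^sup>+u\<in>{0<..}. ennreal (las_mixing_kernel a b \<gamma> u) \<partial>lborel)"
proof -
  have "(\<integral>\<^sup>+\<theta>. las_kernel a b \<gamma> \<theta> \<partial>lborel)
    = (\<integral>\<^sup>+u. (\<integral>\<^sup>+\<theta>. ennreal (normal_density 0 (sqrt u) \<theta> * las_mixing_kernel a b \<gamma> u)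
          * indicator {0<..} u \<partial>lborel) \<partial>lborel)"
    unfolding las_kernel_def normal_density_def
    by (rule lborel_pair.Fubini') measurable
  also have "\<dots> = (\<integral>\<^sup>+u\<in>{0<..}. ennreal (las_mixing_kernel a b \<gamma> u) \<partial>lborel)"
  proof (rule nn_integral_cong)
    fix u :: real
    show "(\<integral>\<^sup>+\<theta>. ennreal (normal_density 0 (sqrt u) \<theta> * las_mixing_kernel a b \<gamma> u)
          * indicator {0<..} u \<partial>lborel)
      = ennreal (las_mixing_kernel a b \<gamma> u) * indicator {0<..} u"
    proof (cases "u > 0")
      case True
      then have "(\<integral>\<^sup>+\<theta>. ennreal (normal_density 0 (sqrt u) \<theta>) \<partial>lborel) = 1"
        using integral_normal_density[of "sqrt u" 0] integrable_normal_density[of "sqrt u" 0]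
        by (subst nn_integral_eq_integral) auto
      then show ?thesis
        using True by (simp add: ennreal_mult las_mixing_kernel_nonneg nn_integral_multc)
    qed auto
  qed
  finally show ?thesis .
qed

section \<open>The pole at the origin\<close>

lemma las_kernel_ge_log:
  assumes "a \<le> 1 / 2" "a + b \<ge> 0" "\<gamma> > 0" "0 < \<bar>\<theta>\<bar>" "\<bar>\<theta>\<bar> < 1"
  defines "C \<equiv> exp (- 1 / 2) / sqrt (2 * pi) * 2 powr (- (a + b)) * (1 + ln 2) powr (- (1 + \<gamma>))"
  shows "ennreal (C * (- ln (\<theta>\<^sup>2))) \<le> las_kernel a b \<gamma> \<theta>"
proof -
  have pos: "0 < \<theta>\<^sup>2" and le1: "\<theta>\<^sup>2 \<le> 1"
    using assms by (auto simp: abs_square_le_1)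
  have "C \<ge> 0"
    by (simp add: C_def)
  have "(\<integral>\<^sup>+u. ennreal (C * inverse u) * indicator {\<theta>\<^sup>2..1} u \<partial>lborel)
      = ennreal (C * ln 1 - C * ln (\<theta>\<^sup>2))"
  proof (rule nn_integral_FTC_Icc[where F = "\<lambda>u. C * ln u"])
    fix u assume "u \<in> {\<theta>\<^sup>2..1}"
    then have "0 < u"
      using order_less_le_trans[OF pos] by simp
    then show "((\<lambda>u. C * ln u) has_real_derivative C * inverse u) (at u)" "0 \<le> C * inverse u"
      using \<open>C \<ge> 0\<close> by (auto intro!: derivative_eq_intros simp: divide_inverse)
  qed (use le1 in auto)
  then have "ennreal (C * (- ln (\<theta>\<^sup>2)))
      = (\<integral>\<^sup>+u. ennreal (C * inverse u) * indicator {\<theta>\<^sup>2..1} u \<partial>lborel)"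
    by simp
  also have "\<dots> \<le> las_kernel a b \<gamma> \<theta>"
    unfolding las_kernel_explicit
  proof (rule nn_integral_mono)
    fix u :: real
    show "ennreal (C * inverse u) * indicator {\<theta>\<^sup>2..1} u
      \<le> ennreal (1 / sqrt (2 * pi * u) * exp (- \<theta>\<^sup>2 / (2 * u)) * u powr (a - 1)
          * (1 + u) powr (- (a + b)) * (1 + ln (1 + u)) powr (- (1 + \<gamma>))) * indicator {0<..} u"
    proof (cases "u \<in> {\<theta>\<^sup>2..1}")
      case True
      then have u: "u \<le> 1" "\<theta>\<^sup>2 \<le> u"
        by auto
      with pos have "0 < u"
        by linarith
      note u = this u
      \<comment> \<open>\<open>C\<close> collects the minima over
        \<open>\<theta>\<^sup>2 \<le> u \<le> 1\<close> of the bounded factors: the exponential is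
        smallest at \<open>u = \<theta>\<^sup>2\<close>, the other two at
        \<open>u = 1\<close>.\<close>
      have "C * inverse u = 1 / sqrt (2 * pi) * exp (- 1 / 2) * inverse u
          * 2 powr (- (a + b)) * (1 + ln 2) powr (- (1 + \<gamma>))"
        by (simp add: C_def field_simps)
      also have "\<dots> \<le> 1 / sqrt (2 * pi) * exp (- \<theta>\<^sup>2 / (2 * u)) * (u powr (a - 3 / 2))
          * (1 + u) powr (- (a + b)) * (1 + ln (1 + u)) powr (- (1 + \<gamma>))"
      proof (intro mult_mono)
        show "exp (- 1 / 2) \<le> exp (- \<theta>\<^sup>2 / (2 * u))"
          using u by (simp add: field_simps)
        \<comment> \<open>Here \<open>a \<le> 1 / 2\<close> enters: the exponent is at most
          \<open>-1\<close> and the base at most \<open>1\<close>.\<close>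
        have "u powr (- 1) \<le> u powr (a - 3 / 2)"
          using u assms by (intro powr_mono') auto
        then show "inverse u \<le> u powr (a - 3 / 2)"
          using u by (simp add: powr_minus)
        show "2 powr (- (a + b)) \<le> (1 + u) powr (- (a + b))"
          using u assms by (intro powr_mono2') auto
        show "(1 + ln 2) powr (- (1 + \<gamma>)) \<le> (1 + ln (1 + u)) powr (- (1 + \<gamma>))"
          using u assms by (intro powr_mono2') (auto intro: add_pos_nonneg)
      qed (use u in auto)
      also have "u powr (a - 3 / 2) = u powr (a - 1) / sqrt u"
        using u by (simp add: powr_half_sqrt[symmetric] powr_diff[symmetric])
      finally have "C * inverse u \<le> 1 / sqrt (2 * pi * u) * exp (- \<theta>\<^sup>2 / (2 * u)) * u powr (a - 1)
          * (1 + u) powr (- (a + b)) * (1 + ln (1 + u)) powr (- (1 + \<gamma>))"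
        by (simp add: real_sqrt_mult field_simps)
      then show ?thesis
        using True u by (auto intro: ennreal_leI)
    qed auto
  qed
  finally show ?thesis .
qed

lemma las_kernel_tendsto_infinity:
  assumes "a \<le> 1 / 2" "a + b \<ge> 0" "\<gamma> > 0"
  shows "(las_kernel a b \<gamma> \<longlongrightarrow> \<infinity>) (at 0)"
proof -
  define C where "C = exp (- 1 / 2) / sqrt (2 * pi) * 2 powr (- (a + b)) * (1 + ln 2) powr (- (1 + \<gamma>))"
  have "1 + ln (2::real) > 0"
    by (simp add: add_pos_nonneg)
  then have "C > 0"
    by (simp add: C_def)
  have "filterlim (\<lambda>\<theta>. C * (- ln (\<theta>\<^sup>2))) at_top (at 0)"
    using \<open>C > 0\<close> by real_asymp
  then have "((\<lambda>\<theta>. ennreal (C * (- ln (\<theta>\<^sup>2)))) \<longlongrightarrow> \<infinity>) (at 0)"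
    by (simp add: ennreal_tendsto_top_eq_at_top)
  moreover have "eventually (\<lambda>\<theta>. ennreal (C * (- ln (\<theta>\<^sup>2))) \<le> las_kernel a b \<gamma> \<theta>) (at 0)"
    unfolding eventually_at
    using las_kernel_ge_log[OF assms] by (intro exI[of _ 1]) (auto simp: C_def)
  \<comment> \<open>The kernel is squeezed between the divergent minorant and the constant
    \<open>\<infinity>\<close>.\<close>
  ultimately show ?thesis
    by (auto intro: tendsto_sandwich[OF _ _ _ tendsto_const] simp: top_greatest)
qed

section \<open>Tail: the slowly varying factor\<close>

definition las_slow :: "real \<Rightarrow> real \<Rightarrow> real" where
  "las_slow \<gamma> x = (1 + ln (1 + x\<^sup>2)) powr (- (1 + \<gamma>))"

lemma las_slow_pos: "las_slow \<gamma> x > 0"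
proof -
  have "ln (1 + x\<^sup>2) \<ge> 0" by simp
  then have "1 + ln (1 + x\<^sup>2) > 0" by linarith
  then show ?thesis by (simp add: las_slow_def)
qed

text \<open>\<open>las_slow\<close> is the logarithmic factor of the mixing kernel at
  \<open>u = x\<^sup>2\<close>. For fixed \<open>v\<close> the logarithms at \<open>M * v\<close>
  and at \<open>M\<close> are both \<open>2 * ln M\<close> up to a bounded term.\<close>

lemma slowly_varying_las_slow:
  assumes "\<gamma> > 0"
  shows "slowly_varying (las_slow \<gamma>)"
proof -
  have "((\<lambda>M. las_slow \<gamma> (M * v) / las_slow \<gamma> M) \<longlongrightarrow> 1) at_top" if "v > 0" for v
    unfolding las_slow_def using that assms by real_asymp
  then show ?thesis
    by (simp add: slowly_varying_def las_slow_pos)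
qed

section \<open>Tail: the inverse gamma kernel of shape \<open>p - 1\<close> and scale
  \<open>1 / 2\<close>\<close>

definition inv_gamma_kernel :: "real \<Rightarrow> real \<Rightarrow> real" where
  "inv_gamma_kernel p v = exp (- 1 / (2 * v)) * v powr (- p)"

text \<open>Controls the kernel near \<open>0\<close>. The inequality \<open>x \<le> exp x\<close>
  is applied at \<open>x = 1 / (2 * v * p)\<close>, chosen so that the \<open>p\<close>-th power of
  the right side is \<open>exp (1 / (2 * v))\<close>.\<close>

lemma inv_gamma_kernel_le:
  assumes "p > 0" "v > 0"
  shows "inv_gamma_kernel p v \<le> (2 * p) powr p"
proof -
  have "1 / (2 * v * p) \<le> exp (1 / (2 * v * p))"
    using exp_ge_add_one_self[of "1 / (2 * v * p)"] by linarith
  then have "(1 / (2 * v * p)) powr p \<le> exp (1 / (2 * v * p)) powr p"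
    using assms by (intro powr_mono2) auto
  also have "\<dots> = exp (1 / (2 * v))"
    using assms by (simp add: exp_powr_real)
  also have "(1 / (2 * v * p)) powr p = v powr (- p) / (2 * p) powr p"
    using assms by (simp add: powr_divide powr_mult powr_minus field_simps)
  finally have "v powr (- p) \<le> exp (1 / (2 * v)) * (2 * p) powr p"
    using assms by (simp add: field_simps)
  then have "exp (- 1 / (2 * v)) * v powr (- p)
      \<le> exp (- 1 / (2 * v)) * (exp (1 / (2 * v)) * (2 * p) powr p)"
    by (intro mult_left_mono) auto
  then show ?thesis
    by (simp add: inv_gamma_kernel_def mult.assoc[symmetric] exp_add[symmetric])
qed

text \<open>Below \<open>1\<close> the kernel is bounded; above \<open>1\<close> the exponential is
  at most \<open>1\<close> and leaves an integrable power.\<close>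

lemma set_integrable_inv_gamma_kernel:
  assumes "p > 1"
  shows "set_integrable lborel {0<..} (inv_gamma_kernel p)"
  unfolding set_integrable_def
proof (rule integrableI_nonneg)
  show "(\<lambda>v. indicator {0<..} v *\<^sub>R inv_gamma_kernel p v) \<in> borel_measurable lborel"
    unfolding inv_gamma_kernel_def by measurable
  show "AE v in lborel. 0 \<le> indicator {0<..} v *\<^sub>R inv_gamma_kernel p v"
    by (auto simp: inv_gamma_kernel_def)
  have "(\<integral>\<^sup>+v. ennreal (indicator {0<..} v *\<^sub>R inv_gamma_kernel p v) \<partial>lborel)
      \<le> (\<integral>\<^sup>+v. ennreal ((2 * p) powr p) * indicator {0..1} v
            + ennreal (v powr (- p)) * indicator {1..} v \<partial>lborel)"
  proof (rule nn_integral_mono)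
    fix v :: real
    consider "v \<le> 0" | "0 < v" "v < 1" | "1 \<le> v" by linarith
    then show "ennreal (indicator {0<..} v *\<^sub>R inv_gamma_kernel p v)
        \<le> ennreal ((2 * p) powr p) * indicator {0..1} v + ennreal (v powr (- p)) * indicator {1..} v"
    proof cases
      case 2
      then show ?thesis
        using inv_gamma_kernel_le[of p v] assms by (auto intro: ennreal_leI)
    next
      case 3
      have "exp (- 1 / (2 * v)) * v powr (- p) \<le> 1 * v powr (- p)"
        using 3 by (intro mult_right_mono) auto
      then have "ennreal (inv_gamma_kernel p v) \<le> ennreal (v powr (- p))"
        by (auto intro: ennreal_leI simp: inv_gamma_kernel_def)
      also have "\<dots> \<le> ennreal ((2 * p) powr p) * indicator {0..1} v + ennreal (v powr (- p))"
        by (intro add_increasing) auto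
      finally show ?thesis
        using 3 by simp
    qed auto
  qed
  also have "\<dots> = (\<integral>\<^sup>+v. ennreal ((2 * p) powr p) * indicator {0..1::real} v \<partial>lborel)
      + (\<integral>\<^sup>+v\<in>{1..}. ennreal (v powr (- p)) \<partial>lborel)"
    by (rule nn_integral_add) auto
  also have "\<dots> < \<infinity>"
    using nn_integral_powr_at_top[OF assms] by (simp add: nn_integral_cmult)
  finally show "(\<integral>\<^sup>+v. ennreal (indicator {0<..} v *\<^sub>R inv_gamma_kernel p v) \<partial>lborel) < \<infinity>" .
qed

text \<open>Allows division by the limiting constant. A zero integral would make the nonnegative
  integrand vanish almost everywhere, but it is positive on \<open>{0<..<1}\<close>.\<close>

lemma set_integral_inv_gamma_kernel_pos:
  assumes "p > 1"
  shows "(LINT v:{0<..}|lborel. inv_gamma_kernel p v) > 0"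
proof -
  let ?f = "\<lambda>v. indicator {0<..} v *\<^sub>R inv_gamma_kernel p v"
  have int: "integrable lborel ?f"
    using set_integrable_inv_gamma_kernel[OF assms] by (simp add: set_integrable_def)
  have nonneg: "AE v in lborel. 0 \<le> ?f v"
    by (auto simp: inv_gamma_kernel_def)
  have "\<not> (AE v in lborel. ?f v = 0)"
  proof
    assume "AE v in lborel. ?f v = 0"
    then have "AE v in lborel. v \<notin> {0<..<1::real}"
      by eventually_elim (auto simp: inv_gamma_kernel_def)
    then have "emeasure lborel {0<..<1::real} = 0"
      by (subst (asm) AE_iff_measurable[where N = "{0<..<1}"]) auto
    then show False by simp
  qed
  then show ?thesis
    using integral_nonneg_eq_0_iff_AE[OF int nonneg] integral_nonneg_AE[OF nonneg]
    by (auto simp: set_lebesgue_integral_def less_le)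
qed

section \<open>Tail: bounds and limit of the ratio of integrands\<close>

lemma log_ratio_le:
  fixes s v :: real
  assumes "v > 0"
  shows "(1 + ln (1 + s\<^sup>2)) / (1 + ln (1 + s\<^sup>2 * v)) \<le> max 1 (1 / v)"
proof -
  have nn: "ln (1 + s\<^sup>2 * v) \<ge> 0"
    using assms by simp
  show ?thesis
  proof (cases "v \<ge> 1")
    case True
    then have "s\<^sup>2 * 1 \<le> s\<^sup>2 * v"
      by (intro mult_left_mono) auto
    then have "ln (1 + s\<^sup>2) \<le> ln (1 + s\<^sup>2 * v)"
      by (intro ln_mono) (auto intro: add_pos_nonneg)
    then show ?thesis
      using nn by (intro max.coboundedI1) simp
  next
    case False
    have pos: "1 + s\<^sup>2 * v > 0"
      using assms by (simp add: add_pos_nonneg)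
    \<comment> \<open>Since \<open>1 / v > 1\<close>, also
      \<open>1 + s\<^sup>2 \<le> 1 / v + s\<^sup>2\<close>. This splits off
      \<open>ln (1 / v)\<close>, a bound free of \<open>s\<close>.\<close>
    have "ln (1 + s\<^sup>2) \<le> ln ((1 + s\<^sup>2 * v) / v)"
      using False assms by (subst ln_le_cancel_iff) (auto simp: field_simps intro: add_pos_nonneg)
    also have "\<dots> = ln (1 + s\<^sup>2 * v) + ln (1 / v)"
      using assms pos by (simp add: ln_div)
    also have "ln (1 / v) \<le> 1 / v - 1"
      using assms by (intro ln_le_minus_one) auto
    finally have "1 + ln (1 + s\<^sup>2) \<le> (1 + ln (1 + s\<^sup>2 * v)) + (1 / v - 1) * 1"
      by simp
    \<comment> \<open>The denominator is at least \<open>1\<close>, so the nonnegative excess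
      \<open>1 / v - 1\<close> may be multiplied by it; it then becomes a common factor.\<close>
    also have "\<dots> \<le> (1 + ln (1 + s\<^sup>2 * v)) + (1 / v - 1) * (1 + ln (1 + s\<^sup>2 * v))"
      using False assms nn by (intro add_left_mono mult_left_mono) auto
    also have "\<dots> = 1 / v * (1 + ln (1 + s\<^sup>2 * v))"
      by (simp add: algebra_simps)
    finally show ?thesis
      using nn by (intro max.coboundedI2) (simp add: pos_divide_le_eq)
  qed
qed

text \<open>With \<open>u = s\<^sup>2 * v\<close>, the first factor is what separates the mixing
  kernel from a pure power of \<open>u\<close>, the second compares its logarithmic factor at
  \<open>u\<close> with that at \<open>s\<^sup>2\<close>.\<close>

definition las_ratio :: "real \<Rightarrow> real \<Rightarrow> real \<Rightarrow> real \<Rightarrow> real \<Rightarrow> real" where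
  "las_ratio a b \<gamma> s v = (s\<^sup>2 * v / (1 + s\<^sup>2 * v)) powr (a + b)
     * ((1 + ln (1 + s\<^sup>2)) / (1 + ln (1 + s\<^sup>2 * v))) powr (1 + \<gamma>)"

lemma las_ratio_nonneg: "las_ratio a b \<gamma> s v \<ge> 0"
  by (simp add: las_ratio_def)

text \<open>The first factor is at most \<open>1\<close>; the second is bounded by
  \<open>log_ratio_le\<close>. Replacing the maximum by a sum keeps the product with an inverse
  gamma kernel within that family.\<close>

lemma las_ratio_le:
  assumes "v > 0" "a + b \<ge> 0" "\<gamma> > 0"
  shows "las_ratio a b \<gamma> s v \<le> 1 + v powr (- (1 + \<gamma>))"
proof -
  have "(s\<^sup>2 * v / (1 + s\<^sup>2 * v)) powr (a + b) \<le> 1"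
    using assms by (intro powr_le1) (auto simp: divide_le_eq_1 add_pos_nonneg)
  moreover have "((1 + ln (1 + s\<^sup>2)) / (1 + ln (1 + s\<^sup>2 * v))) powr (1 + \<gamma>) \<le> max 1 (1 / v) powr (1 + \<gamma>)"
    using assms log_ratio_le[of v s] by (intro powr_mono2) (auto intro!: divide_nonneg_nonneg add_nonneg_nonneg)
  moreover have "max 1 (1 / v) powr (1 + \<gamma>) \<le> 1 + v powr (- (1 + \<gamma>))"
    using assms by (auto simp: max_def powr_divide powr_minus_divide[of v "1 + \<gamma>"] simp del: minus_add_distrib)
  ultimately have "las_ratio a b \<gamma> s v \<le> 1 * (1 + v powr (- (1 + \<gamma>)))"
    unfolding las_ratio_def by (intro mult_mono) auto
  then show ?thesis by simp
qed

lemma las_ratio_tendsto: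
  assumes "v > 0" "\<gamma> > 0"
  shows "((\<lambda>s. las_ratio a b \<gamma> s v) \<longlongrightarrow> 1) at_top"
proof -
  have "((\<lambda>s. s\<^sup>2 * v / (1 + s\<^sup>2 * v)) \<longlongrightarrow> 1) at_top"
    using assms by real_asymp
  then have 1: "((\<lambda>s. (s\<^sup>2 * v / (1 + s\<^sup>2 * v)) powr (a + b)) \<longlongrightarrow> 1 powr (a + b)) at_top"
    by (intro tendsto_powr) auto
  have "((\<lambda>s. (1 + ln (1 + s\<^sup>2)) / (1 + ln (1 + s\<^sup>2 * v))) \<longlongrightarrow> 1) at_top"
    using assms by real_asymp
  then have 2: "((\<lambda>s. ((1 + ln (1 + s\<^sup>2)) / (1 + ln (1 + s\<^sup>2 * v))) powr (1 + \<gamma>)) \<longlongrightarrow> 1 powr (1 + \<gamma>)) at_top"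
    by (intro tendsto_powr) auto
  show ?thesis
    using tendsto_mult[OF 1 2] by (simp add: las_ratio_def)
qed

section \<open>Tail: dominated convergence for the rescaled integrand\<close>

definition las_profile :: "real \<Rightarrow> real \<Rightarrow> real \<Rightarrow> real \<Rightarrow> real \<Rightarrow> real" where
  "las_profile a b \<gamma> s v =
     indicator {0<..} v *\<^sub>R (inv_gamma_kernel (b + 3 / 2) v * las_ratio a b \<gamma> s v)"

lemma borel_measurable_las_profile [measurable]: "las_profile a b \<gamma> s \<in> borel_measurable borel"
  unfolding las_profile_def inv_gamma_kernel_def las_ratio_def by measurable

text \<open>Both claims rest on one majorant independent of \<open>s\<close>: the bound
  \<open>las_ratio_le\<close> turns the profile into two inverse gamma kernels, with exponents
  \<open>b + 3 / 2\<close> and \<open>b + 3 / 2 + (1 + \<gamma>)\<close>, both above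
  \<open>1\<close>.\<close>

lemma
  assumes "a > 0" "b \<ge> 0" "\<gamma> > 0"
  shows integrable_las_profile: "integrable lborel (las_profile a b \<gamma> s)"
    and integral_las_profile_tendsto:
      "((\<lambda>s. LINT v|lborel. las_profile a b \<gamma> s v)
          \<longlongrightarrow> (LINT v:{0<..}|lborel. inv_gamma_kernel (b + 3 / 2) v)) at_top"
proof -
  let ?k = "inv_gamma_kernel (b + 3 / 2)"
  define w where "w v = indicator {0<..} v *\<^sub>R ?k v
      + indicator {0<..} v *\<^sub>R inv_gamma_kernel (b + 3 / 2 + (1 + \<gamma>)) v" for v
  have w: "integrable lborel w"
    unfolding w_def using assms
      set_integrable_inv_gamma_kernel[of "b + 3 / 2"]
      set_integrable_inv_gamma_kernel[of "b + 3 / 2 + (1 + \<gamma>)"]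
    by (intro Bochner_Integration.integrable_add) (auto simp: set_integrable_def)
  have le: "norm (las_profile a b \<gamma> s v) \<le> w v" for s v
  proof (cases "v > 0")
    case True
    have "?k v * las_ratio a b \<gamma> s v \<le> ?k v * (1 + v powr (- (1 + \<gamma>)))"
      using True assms by (intro mult_left_mono las_ratio_le) (auto simp: inv_gamma_kernel_def)
    also have "\<dots> = w v"
      using True by (simp add: w_def inv_gamma_kernel_def distrib_left powr_add[symmetric])
    finally show ?thesis
      using True las_ratio_nonneg[of a b \<gamma> s v]
      by (simp add: las_profile_def abs_mult) (simp add: inv_gamma_kernel_def)
  qed (simp add: las_profile_def w_def)
  show "integrable lborel (las_profile a b \<gamma> s)"
    by (rule Bochner_Integration.integrable_bound[OF w])
      (use le in \<open>auto intro: order_trans[OF _ abs_ge_self]\<close>)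
  have lim: "((\<lambda>s. las_profile a b \<gamma> s v) \<longlongrightarrow> indicator {0<..} v *\<^sub>R ?k v) at_top" for v
  proof (cases "v > 0")
    case True
    then show ?thesis
      using tendsto_mult[OF tendsto_const[of "?k v"] las_ratio_tendsto[OF True assms(3), of a b]]
      by (simp add: las_profile_def)
  qed (simp add: las_profile_def)
  have [measurable]: "?k \<in> borel_measurable borel"
    unfolding inv_gamma_kernel_def by measurable
  show "((\<lambda>s. LINT v|lborel. las_profile a b \<gamma> s v) \<longlongrightarrow> (LINT v:{0<..}|lborel. ?k v)) at_top"
    unfolding set_lebesgue_integral_def
    by (rule integral_dominated_convergence_at_top[OF _ _ w]) (use le lim in \<open>auto simp del: real_scaleR_def\<close>)
qed

section \<open>Tail: the substitution \<open>u = s\<^sup>2 * v\<close>\<close>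

lemma scaled_las_integrand:
  assumes "s > 0" "v > 0"
  shows "s\<^sup>2 * (normal_density 0 (sqrt (s\<^sup>2 * v)) s * las_mixing_kernel a b \<gamma> (s\<^sup>2 * v))
    = s powr (- 2 * b - 1) * las_slow \<gamma> s / sqrt (2 * pi)
      * (inv_gamma_kernel (b + 3 / 2) v * las_ratio a b \<gamma> s v)"
proof -
  define u where "u = s\<^sup>2 * v"
  have u: "u > 0"
    using assms by (simp add: u_def)
  define L where "L = 1 + ln (1 + u)"
  define L1 where "L1 = 1 + ln (1 + s\<^sup>2)"
  have L: "L > 0"
    using u by (simp add: L_def add_pos_nonneg)
  have L1: "L1 > 0"
    by (simp add: L1_def add_pos_nonneg)
  have s2: "s\<^sup>2 = s powr 2"
    using assms by simp
  \<comment> \<open>The scaling is chosen for this: \<open>s\<^sup>2 / (2 * u)\<close> becomes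
    \<open>1 / (2 * v)\<close>, free of \<open>s\<close>.\<close>
  have nd: "normal_density 0 (sqrt u) s = exp (- 1 / (2 * v)) / (sqrt (2 * pi) * sqrt u)"
    using u assms by (simp add: normal_density_def real_sqrt_mult u_def power2_eq_square)
  \<comment> \<open>Writing \<open>u powr (a - 1)\<close> as
    \<open>u powr (- b - 1) * u powr (a + b)\<close> isolates the decay and leaves a quotient
    tending to \<open>1\<close> as \<open>u\<close> grows.\<close>
  have mk: "las_mixing_kernel a b \<gamma> u = u powr (- b - 1) * (u / (1 + u)) powr (a + b) * L powr (- (1 + \<gamma>))"
  proof -
    have "u powr (a - 1) = u powr (- b - 1) * u powr (a + b)"
      by (simp add: powr_add[symmetric])
    then show ?thesis
      using u by (simp add: las_mixing_kernel_def L_def powr_divide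
          powr_minus_divide[of "1 + u" "a + b"] del: minus_add_distrib)
  qed
  have e1: "u powr (- b - 1) / sqrt u = u powr (- (b + 3 / 2))"
    using u by (simp add: powr_half_sqrt[symmetric] powr_diff[symmetric] minus_diff_commute)
  \<comment> \<open>The Jacobian \<open>s\<^sup>2\<close> gives the exponent
    \<open>2 - 2 * (b + 3 / 2) = - 2 * b - 1\<close>.\<close>
  have e2: "s\<^sup>2 * u powr (- (b + 3 / 2)) = s powr (- 2 * b - 1) * v powr (- (b + 3 / 2))"
  proof -
    have "u powr (- (b + 3 / 2)) = (s powr 2) powr (- (b + 3 / 2)) * v powr (- (b + 3 / 2))"
      unfolding u_def s2 using assms by (simp add: powr_mult)
    then show ?thesis
      unfolding s2 by (simp add: powr_powr powr_add[symmetric] mult.assoc[symmetric] algebra_simps minus_diff_commute)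
  qed
  have e3: "L powr (- (1 + \<gamma>)) = las_slow \<gamma> s * (L1 / L) powr (1 + \<gamma>)"
  proof -
    have "las_slow \<gamma> s = 1 / L1 powr (1 + \<gamma>)"
      by (simp only: las_slow_def L1_def powr_minus_divide)
    then show ?thesis
      using L L1 by (simp only: powr_divide powr_minus_divide) simp
  qed
  have "s\<^sup>2 * (normal_density 0 (sqrt u) s * las_mixing_kernel a b \<gamma> u)
    = s\<^sup>2 * (u powr (- b - 1) / sqrt u) * exp (- 1 / (2 * v)) / sqrt (2 * pi)
      * ((u / (1 + u)) powr (a + b) * L powr (- (1 + \<gamma>)))"
    by (simp only: nd mk times_divide_eq_left times_divide_eq_right divide_divide_eq_left mult_ac)
  also have "\<dots> = s powr (- 2 * b - 1) * las_slow \<gamma> s / sqrt (2 * pi)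
      * (exp (- 1 / (2 * v)) * v powr (- (b + 3 / 2))
        * ((u / (1 + u)) powr (a + b) * (L1 / L) powr (1 + \<gamma>)))"
    by (simp only: e1 e2 e3 times_divide_eq_left times_divide_eq_right mult_ac)
  finally show ?thesis
    by (simp only: u_def L_def L1_def inv_gamma_kernel_def las_ratio_def)
qed

text \<open>Evenness in \<open>\<theta>\<close> reduces the claim to
  \<open>s = \<bar>\<theta>\<bar> > 0\<close>, where the substitution applies. Integrability of the
  profile turns the extended integral into a real one, so the kernel is finite off the
  origin.\<close>

lemma las_kernel_eq:
  assumes "a > 0" "b \<ge> 0" "\<gamma> > 0" "\<theta> \<noteq> 0"
  shows "las_kernel a b \<gamma> \<theta> = ennreal (\<bar>\<theta>\<bar> powr (- 2 * b - 1) * las_slow \<gamma> \<bar>\<theta>\<bar> / sqrt (2 * pi)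
    * (LINT v|lborel. las_profile a b \<gamma> \<bar>\<theta>\<bar> v))"
proof -
  define s where "s = \<bar>\<theta>\<bar>"
  have s: "s > 0"
    using assms by (simp add: s_def)
  let ?c = "s powr (- 2 * b - 1) * las_slow \<gamma> s / sqrt (2 * pi)"
  have c: "?c \<ge> 0"
    using las_slow_pos[of \<gamma> s] by simp
  have "las_kernel a b \<gamma> \<theta> = las_kernel a b \<gamma> s"
    by (simp add: las_kernel_def normal_density_def s_def)
  \<comment> \<open>Affine change of variables with shift \<open>0\<close> and slope
    \<open>s\<^sup>2\<close>; the leading factor is its Jacobian.\<close>
  also have "\<dots> = ennreal \<bar>s\<^sup>2\<bar> * (\<integral>\<^sup>+v. ennreal (normal_density 0 (sqrt (0 + s\<^sup>2 * v)) s
      * las_mixing_kernel a b \<gamma> (0 + s\<^sup>2 * v)) * indicator {0<..} (0 + s\<^sup>2 * v) \<partial>lborel)"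
    unfolding las_kernel_def
    by (rule nn_integral_real_affine) (use s in \<open>auto simp: normal_density_def\<close>)
  also have "\<dots> = (\<integral>\<^sup>+v. ennreal (?c * las_profile a b \<gamma> s v) \<partial>lborel)"
  proof (subst nn_integral_cmult[symmetric])
    show "(\<integral>\<^sup>+v. ennreal \<bar>s\<^sup>2\<bar> * (ennreal (normal_density 0 (sqrt (0 + s\<^sup>2 * v)) s
        * las_mixing_kernel a b \<gamma> (0 + s\<^sup>2 * v)) * indicator {0<..} (0 + s\<^sup>2 * v)) \<partial>lborel)
      = (\<integral>\<^sup>+v. ennreal (?c * las_profile a b \<gamma> s v) \<partial>lborel)"
    proof (rule nn_integral_cong)
      fix v :: real
      show "ennreal \<bar>s\<^sup>2\<bar> * (ennreal (normal_density 0 (sqrt (0 + s\<^sup>2 * v)) s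
          * las_mixing_kernel a b \<gamma> (0 + s\<^sup>2 * v)) * indicator {0<..} (0 + s\<^sup>2 * v))
        = ennreal (?c * las_profile a b \<gamma> s v)"
      proof (cases "v > 0")
        case True
        then have "0 < s\<^sup>2 * v"
          using s by simp
        then show ?thesis
          using scaled_las_integrand[OF s True, of a b \<gamma>] True
          by (simp add: las_profile_def ennreal_mult'[symmetric])
      next
        case False
        then have "\<not> 0 < s\<^sup>2 * v"
          using s by (simp add: zero_less_mult_iff)
        then show ?thesis
          using False by (simp add: las_profile_def)
      qed
    qed
  qed (auto simp: normal_density_def)
  also have "\<dots> = ennreal (LINT v|lborel. ?c * las_profile a b \<gamma> s v)"
  proof (rule nn_integral_eq_integral)
    show "integrable lborel (\<lambda>v. ?c * las_profile a b \<gamma> s v)"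
      using integrable_las_profile[OF assms(1-3)] by (rule integrable_mult_right)
    show "AE v in lborel. 0 \<le> ?c * las_profile a b \<gamma> s v"
      using c by (intro AE_I2 mult_nonneg_nonneg)
        (auto simp: las_profile_def las_ratio_nonneg inv_gamma_kernel_def)
  qed
  finally show ?thesis
    unfolding s_def by simp
qed

section \<open>The three claims for an arbitrary multiple of the kernel\<close>

theorem theorem1:
  fixes a b \<gamma> :: real and \<pi> :: "real \<Rightarrow> ennreal"
  assumes "a > 0" and "b \<ge> 0" and "\<gamma> > 0"
    and "log_adjusted_shrinkage_prior a b \<gamma> \<pi>"
  shows "(\<integral>\<^sup>+\<theta>. \<pi> \<theta> \<partial>lborel) < \<infinity>
    \<and> (a \<le> 1 / 2 \<longrightarrow> (\<pi> \<longlongrightarrow> \<infinity>) (at 0))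
    \<and> (\<exists>(c::real) l. c > 0 \<and> slowly_varying l \<and>
         ((\<lambda>\<theta>. \<pi> \<theta> / ennreal (c * \<bar>\<theta>\<bar> powr (- 2 * b - 1) * l \<bar>\<theta>\<bar>)) \<longlongrightarrow> 1) at_infinity)"
proof -
  obtain K :: real where K: "K > 0" and \<pi>: "\<pi> = (\<lambda>\<theta>. ennreal K * las_kernel a b \<gamma> \<theta>)"
    using assms(4) unfolding log_adjusted_shrinkage_prior_def by auto
  have [measurable]: "las_kernel a b \<gamma> \<in> borel_measurable borel"
    unfolding las_kernel_def normal_density_def by measurable
  have proper: "(\<integral>\<^sup>+\<theta>. \<pi> \<theta> \<partial>lborel) < \<infinity>"
    using nn_integral_las_mixing_kernel_finite[OF assms(1-3)]
    by (simp add: \<pi> nn_integral_cmult nn_integral_las_kernel ennreal_mult_less_top)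
  have pole: "(\<pi> \<longlongrightarrow> \<infinity>) (at 0)" if "a \<le> 1 / 2"
  proof -
    \<comment> \<open>\<open>K > 0\<close> rules out the product of \<open>0\<close> and
      \<open>\<infinity>\<close>, where multiplication is not continuous.\<close>
    have "((\<lambda>\<theta>. ennreal K * las_kernel a b \<gamma> \<theta>) \<longlongrightarrow> ennreal K * \<infinity>) (at 0)"
      using K assms that
      by (intro tendsto_mult_ennreal tendsto_const las_kernel_tendsto_infinity) auto
    then show ?thesis
      using K by (simp add: \<pi> ennreal_mult_top)
  qed
  let ?J = "\<lambda>s. LINT v|lborel. las_profile a b \<gamma> s v"
  define I where "I = (LINT v:{0<..}|lborel. inv_gamma_kernel (b + 3 / 2) v)"
  have I: "I > 0"
    unfolding I_def using assms by (intro set_integral_inv_gamma_kernel_pos) simp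
  \<comment> \<open>\<open>c\<close> absorbs the scale \<open>K\<close>, the normal constant and the
    limit \<open>I\<close>, so that the quotient below has limit exactly \<open>1\<close>.\<close>
  define c where "c = K * I / sqrt (2 * pi)"
  have c: "c > 0"
    using K I by (simp add: c_def)
  have "((\<lambda>s. ?J s / I) \<longlongrightarrow> I / I) at_top"
    using integral_las_profile_tendsto[OF assms(1-3)] I unfolding I_def
    by (intro tendsto_divide tendsto_const) auto
  then have "((\<lambda>s. ?J s / I) \<longlongrightarrow> 1) at_top"
    using I by simp
  \<comment> \<open>Composition with the norm covers both ends of the line at once.\<close>
  then have "((\<lambda>\<theta>::real. ?J \<bar>\<theta>\<bar> / I) \<longlongrightarrow> 1) at_infinity"
    using filterlim_compose[OF _ filterlim_norm_at_top[where 'a = real]] by (force simp only: real_norm_def)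
  then have "((\<lambda>\<theta>::real. ennreal (?J \<bar>\<theta>\<bar> / I)) \<longlongrightarrow> ennreal 1) at_infinity"
    by (rule tendsto_ennrealI)
  \<comment> \<open>For \<open>\<theta> \<noteq> 0\<close> this is an exact identity:
    \<open>K\<close>, the power and the slowly varying factor cancel.\<close>
  moreover have "eventually (\<lambda>\<theta>. ennreal (?J \<bar>\<theta>\<bar> / I)
      = \<pi> \<theta> / ennreal (c * \<bar>\<theta>\<bar> powr (- 2 * b - 1) * las_slow \<gamma> \<bar>\<theta>\<bar>)) at_infinity"
    using eventually_not_equal_at_infinity[of 0]
  proof eventually_elim
    case (elim \<theta>)
    define q where "q = \<bar>\<theta>\<bar> powr (- 2 * b - 1) * las_slow \<gamma> \<bar>\<theta>\<bar>"
    have q: "q > 0"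
      using elim las_slow_pos[of \<gamma> "\<bar>\<theta>\<bar>"] by (simp add: q_def)
    have J: "?J \<bar>\<theta>\<bar> \<ge> 0"
      by (intro integral_nonneg_AE AE_I2)
        (auto simp: las_profile_def las_ratio_nonneg inv_gamma_kernel_def)
    have "\<pi> \<theta> = ennreal (K * (q / sqrt (2 * pi) * ?J \<bar>\<theta>\<bar>))"
      using K by (simp only: \<pi> las_kernel_eq[OF assms(1-3) elim] q_def ennreal_mult'[OF less_imp_le])
    then have "\<pi> \<theta> / ennreal (c * q) = ennreal (K * (q / sqrt (2 * pi) * ?J \<bar>\<theta>\<bar>) / (c * q))"
      using K c q J by (simp add: divide_ennreal)
    also have "K * (q / sqrt (2 * pi) * ?J \<bar>\<theta>\<bar>) / (c * q) = ?J \<bar>\<theta>\<bar> / I"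
      using K I q by (simp add: c_def)
    finally show ?case
      by (simp add: q_def mult.assoc)
  qed
  ultimately have "((\<lambda>\<theta>. \<pi> \<theta> / ennreal (c * \<bar>\<theta>\<bar> powr (- 2 * b - 1) * las_slow \<gamma> \<bar>\<theta>\<bar>)) \<longlongrightarrow> 1)
      at_infinity"
    by (auto elim: Lim_transform_eventually)
  then show ?thesis
    using proper pole c slowly_varying_las_slow[OF assms(3)] by blast
qed

end
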